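(* Let $\Omega\subset\mathbb{C}$ be a simply connected domain, let $\nu:\Omega\to\mathbb{R}$ be a real-valued function, and let $Q:\Omega\to\mathbb{C}$ be a solution of the complex differential Riccati equation $$\partial_{\overline z}Q+|Q|^2=\frac{\nu}{4}\quad\text{in }\Omega.$$ Then the function $u=e^{A[Q]}$ is a solution of the stationary Schrödinger equation $(-\Delta+\nu)u=0$ in $\Omega$.
   Context: Here $z=x+iy$, $\partial_{\overline z}=\frac12(\partial_x+i\partial_y)$, $\partial_z=\frac12(\partial_x-i\partial_y)$, $\Delta=\partial_x^2+\partial_y^2$. Solutions are understood in the classical sense ($u$ twice continuously differentiable, $Q$ continuously differentiable). For a complex-valued function $\Phi=\Phi_1+i\Phi_2$ (with $\Phi_1,\Phi_2$ real) on a simply connected domain satisfying $\partial_y\Phi_1+\partial_x\Phi_2=0$, one defines the real-valued function $$A[\Phi](x,y)=2\int_{\Gamma}\left(\Phi_1\,dx-\Phi_2\,dy\right)+c,$$ where $\Gamma$ is an arbitrary rectifiable curve in the domain from a fixed point $(x_0,y_0)$ to $(x,y)$ and $c$ is an arbitrary real constant; it satisfies $\partial_z A[\Phi]=\Phi$. Every solution $Q=Q_1+iQ_2$ of the Riccati equation satisfies $\partial_yQ_1+\partial_xQ_2=0$ (the imaginary part of the equation, since $\nu$ is real), so $A[Q]$ is defined. *)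

theory Defs
  imports "HOL-Analysis.Analysis"
begin

section \<open>Partial derivatives and differential operators in the plane\<close>

text \<open>The plane is the type \<^typ>\<open>complex\<close>, with real coordinates \<open>x = Re z\<close> and \<open>y = Im z\<close>.
  Functions on a domain are total functions on \<^typ>\<open>complex\<close> of which only the values on the
  domain matter; the operators below are applied at points of open sets only.\<close>

definition partial_x :: "(complex \<Rightarrow> 'a::real_normed_vector) \<Rightarrow> complex \<Rightarrow> 'a" where
  "partial_x f z = vector_derivative (\<lambda>t::real. f (z + of_real t)) (at 0)"

definition partial_y :: "(complex \<Rightarrow> 'a::real_normed_vector) \<Rightarrow> complex \<Rightarrow> 'a" where
  "partial_y f z = vector_derivative (\<lambda>t::real. f (z + \<i> * of_real t)) (at 0)"

definition dzbar :: "(complex \<Rightarrow> complex) \<Rightarrow> complex \<Rightarrow> complex" where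
  "dzbar f z = (partial_x f z + \<i> * partial_y f z) / 2"

definition laplacian :: "(complex \<Rightarrow> 'a::real_normed_vector) \<Rightarrow> complex \<Rightarrow> 'a" where
  "laplacian f z = partial_x (partial_x f) z + partial_y (partial_y f) z"

text \<open>Real differentiability is meant: \<open>differentiable\<close> is the existence of a Frechet derivative
  over the reals.\<close>

definition C1_on :: "complex set \<Rightarrow> (complex \<Rightarrow> 'a::real_normed_vector) \<Rightarrow> bool" where
  "C1_on S f \<longleftrightarrow> (\<forall>z\<in>S. f differentiable (at z)) \<and>
     continuous_on S (partial_x f) \<and> continuous_on S (partial_y f)"

definition C2_on :: "complex set \<Rightarrow> (complex \<Rightarrow> 'a::real_normed_vector) \<Rightarrow> bool" where
  "C2_on S f \<longleftrightarrow> C1_on S f \<and> C1_on S (partial_x f) \<and> C1_on S (partial_y f)"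


section \<open>Rectifiable curves and line integrals\<close>

definition rectifiable_path :: "(real \<Rightarrow> complex) \<Rightarrow> bool" where
  "rectifiable_path g \<longleftrightarrow> path g \<and>
     (\<exists>L. \<forall>D. D division_of {0..1} \<longrightarrow> (\<Sum>K\<in>D. dist (g (Inf K)) (g (Sup K))) \<le> L)"

definition rectifiable_path_from_to ::
    "complex set \<Rightarrow> complex \<Rightarrow> complex \<Rightarrow> (real \<Rightarrow> complex) \<Rightarrow> bool" where
  "rectifiable_path_from_to S a b g \<longleftrightarrow>
     rectifiable_path g \<and> path_image g \<subseteq> S \<and> pathstart g = a \<and> pathfinish g = b"

text \<open>The integral of \<open>P dx + R dy\<close> along a curve \<open>g\<close>, as the Riemann--Stieltjes limit of
  sums over tagged divisions whose mesh tends to zero. No derivative of \<open>g\<close> is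
  involved, so that arbitrary rectifiable curves are covered.\<close>

definition has_line_integral ::
    "(complex \<Rightarrow> real) \<Rightarrow> (complex \<Rightarrow> real) \<Rightarrow> (real \<Rightarrow> complex) \<Rightarrow> real \<Rightarrow> bool" where
  "has_line_integral P R g I \<longleftrightarrow>
     (\<forall>e>0. \<exists>d>0. \<forall>p. p tagged_division_of {0..1} \<and> (\<lambda>t. ball t d) fine p \<longrightarrow>
        \<bar>(\<Sum>(t, K)\<in>p. P (g t) * (Re (g (Sup K)) - Re (g (Inf K)))
                     + R (g t) * (Im (g (Sup K)) - Im (g (Inf K)))) - I\<bar> < e)"

lemma has_line_integral_unique:
  assumes "has_line_integral P R g I" and "has_line_integral P R g J"
  shows "I = J"
proof (rule ccontr)
  assume "I \<noteq> J"
  then have e: "\<bar>I - J\<bar> / 2 > 0" by simp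
  define S where "S p = (\<Sum>(t, K)\<in>p. P (g t) * (Re (g (Sup K)) - Re (g (Inf K)))
                     + R (g t) * (Im (g (Sup K)) - Im (g (Inf K))))" for p
  from assms(1) e obtain d1 where d1: "d1 > 0" "\<forall>p. p tagged_division_of {0..1} \<and> (\<lambda>t. ball t d1) fine p
      \<longrightarrow> \<bar>S p - I\<bar> < \<bar>I - J\<bar> / 2"
    unfolding has_line_integral_def S_def by meson
  from assms(2) e obtain d2 where d2: "d2 > 0" "\<forall>p. p tagged_division_of {0..1} \<and> (\<lambda>t. ball t d2) fine p
      \<longrightarrow> \<bar>S p - J\<bar> < \<bar>I - J\<bar> / 2"
    unfolding has_line_integral_def S_def by meson
  have "gauge (\<lambda>t::real. ball t (min d1 d2))"
    using d1(1) d2(1) by (simp add: gauge_def)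
  then obtain p where p: "p tagged_division_of cbox 0 (1::real)"
      "(\<lambda>t. ball t (min d1 d2)) fine p"
    using fine_division_exists by blast
  have "(\<lambda>t. ball t d1) fine p" "(\<lambda>t. ball t d2) fine p"
    using p(2) unfolding fine_def by (auto dest!: bspec)
  moreover have "p tagged_division_of {0..1}"
    using p(1) by simp
  ultimately have "\<bar>S p - I\<bar> < \<bar>I - J\<bar> / 2" "\<bar>S p - J\<bar> < \<bar>I - J\<bar> / 2"
    using d1(2) d2(2) by blast+
  moreover have "\<bar>I - J\<bar> \<le> \<bar>S p - I\<bar> + \<bar>S p - J\<bar>"
    using abs_triangle_ineq4[of "S p - J" "S p - I"] by simp
  ultimately show False by argo
qed

definition line_integral ::
    "(complex \<Rightarrow> real) \<Rightarrow> (complex \<Rightarrow> real) \<Rightarrow> (real \<Rightarrow> complex) \<Rightarrow> real" where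
  "line_integral P R g = (THE I. has_line_integral P R g I)"


section \<open>The operator A and the two equations\<close>

text \<open>\<open>\<Gamma> z\<close> is the curve, from the base point to \<open>z\<close>, along which the value at \<open>z\<close> is computed,
  and \<open>c\<close> is the additive constant. Independence of the choice of curves is not built
  into the definition.\<close>

definition A_op :: "(complex \<Rightarrow> real \<Rightarrow> complex) \<Rightarrow> real \<Rightarrow> (complex \<Rightarrow> complex) \<Rightarrow> complex \<Rightarrow> real" where
  "A_op \<Gamma> c \<Phi> z = 2 * line_integral (\<lambda>w. Re (\<Phi> w)) (\<lambda>w. - Im (\<Phi> w)) (\<Gamma> z) + c"

definition riccati_solution :: "complex set \<Rightarrow> (complex \<Rightarrow> real) \<Rightarrow> (complex \<Rightarrow> complex) \<Rightarrow> bool" where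
  "riccati_solution \<Omega> \<nu> Q \<longleftrightarrow> C1_on \<Omega> Q \<and>
     (\<forall>z\<in>\<Omega>. dzbar Q z + of_real ((cmod (Q z))\<^sup>2) = of_real (\<nu> z / 4))"

definition schroedinger_solution :: "complex set \<Rightarrow> (complex \<Rightarrow> real) \<Rightarrow> (complex \<Rightarrow> real) \<Rightarrow> bool" where
  "schroedinger_solution \<Omega> \<nu> u \<longleftrightarrow> C2_on \<Omega> u \<and>
     (\<forall>z\<in>\<Omega>. - laplacian u z + \<nu> z * u z = 0)"

end

theory Submission
  imports Defs "HOL-Complex_Analysis.Complex_Analysis"
begin

text \<open>The imaginary part of the Riccati equation says that \<open>Re (Q dz)\<close> is closed. It has a
  primitive \<open>F\<close> on \<open>\<Omega>\<close>: integrate radially on the disc or the plane, and transport by a Riemann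
  map. Hence \<open>A[Q] = 2 F + const\<close> whatever the curves, and \<open>\<Delta> e\<^sup>A = (\<Delta> A + \<bar>\<nabla> A\<bar>\<^sup>2) e\<^sup>A\<close>, where
  \<open>\<Delta> A + \<bar>\<nabla> A\<bar>\<^sup>2 = 4 Re (\<partial>Q/\<partial>(cnj z)) + 4 (cmod Q)\<^sup>2 = \<nu>\<close> by the real part.\<close>

section \<open>Partial derivatives\<close>

text \<open>One computation serves both partials: \<open>v = 1\<close> and \<open>v = \<i>\<close>
  give the lines used in \<open>partial_x\<close> and \<open>partial_y\<close>.\<close>

lemma has_derivative_imp_has_partial:
  fixes f :: "complex \<Rightarrow> 'a::real_normed_vector"
  assumes "(f has_derivative D) (at z)"
  shows "((\<lambda>t::real. f (z + v * of_real t)) has_vector_derivative D v) (at 0)"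
proof -
  interpret D: bounded_linear D using assms by (rule has_derivative_bounded_linear)
  have 1: "((\<lambda>t::real. z + v * of_real t) has_derivative (\<lambda>t. v * of_real t)) (at 0)"
    by (auto intro!: derivative_eq_intros)
  have "((\<lambda>t::real. f (z + v * of_real t)) has_derivative (\<lambda>t. D (v * of_real t))) (at 0)"
    using has_derivative_compose[OF 1, of f D] assms by simp
  moreover have "D (v * of_real t) = t *\<^sub>R D v" for t
    by (metis D.scaleR mult.commute scaleR_conv_of_real)
  ultimately show ?thesis by (simp add: has_vector_derivative_def)
qed

lemma has_derivative_imp_partial_x:
  assumes "(f has_derivative D) (at z)" shows "partial_x f z = D 1"
  using has_derivative_imp_has_partial[OF assms, of 1]
  by (simp add: partial_x_def vector_derivative_at)

lemma has_derivative_imp_partial_y: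
  assumes "(f has_derivative D) (at z)" shows "partial_y f z = D \<i>"
  using has_derivative_imp_has_partial[OF assms, of \<i>]
  by (simp add: partial_y_def vector_derivative_at)

text \<open>A real linear map on the plane is determined by its values at \<open>1\<close> and
  \<open>\<i>\<close>, and these are the partials. This turns the differentiability in
  \<open>C1_on\<close> into an explicit linear map.\<close>

lemma differentiable_imp_has_derivative_partials:
  fixes f :: "complex \<Rightarrow> 'a::real_normed_vector"
  assumes "f differentiable (at z)"
  shows "(f has_derivative (\<lambda>h. Re h *\<^sub>R partial_x f z + Im h *\<^sub>R partial_y f z)) (at z)"
proof -
  obtain D where D: "(f has_derivative D) (at z)"
    using assms by (auto simp: differentiable_def)
  interpret D: bounded_linear D using D by (rule has_derivative_bounded_linear)
  have "D h = Re h *\<^sub>R partial_x f z + Im h *\<^sub>R partial_y f z" for h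
  proof -
    have "h = Re h *\<^sub>R 1 + Im h *\<^sub>R \<i>"
      by (simp add: complex_eq_iff)
    then have "D h = D (Re h *\<^sub>R 1 + Im h *\<^sub>R \<i>)" by simp
    also have "\<dots> = Re h *\<^sub>R D 1 + Im h *\<^sub>R D \<i>"
      by (simp only: D.add D.scaleR)
    finally show ?thesis
      by (simp add: has_derivative_imp_partial_x[OF D] has_derivative_imp_partial_y[OF D])
  qed
  then have "D = (\<lambda>h. Re h *\<^sub>R partial_x f z + Im h *\<^sub>R partial_y f z)" by blast
  then show ?thesis using D by simp
qed

section \<open>Primitives of the form Re (Q dz)\<close>

text \<open>In Wirtinger form the derivative of \<open>Q\<close> is \<open>h \<mapsto> a h + b (cnj h)\<close> with \<open>b = \<partial>Q/\<partial>(cnj z)\<close>,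
  and the form \<open>Re (Q dz) = Re Q dx - Im Q dy\<close> is closed exactly when \<open>b\<close> is real.\<close>

lemma has_primitive_convex:
  fixes Q a :: "complex \<Rightarrow> complex" and b :: "complex \<Rightarrow> real"
  assumes S: "open S" "convex S" "0 \<in> S"
    and Q: "\<And>z. z \<in> S \<Longrightarrow> (Q has_derivative (\<lambda>h. a z * h + of_real (b z) * cnj h)) (at z)"
    and a: "continuous_on S a" and b: "continuous_on S b"
  shows "\<exists>F. \<forall>z\<in>S. (F has_derivative (\<lambda>h. Re (Q z * h))) (at z)"
proof -
  \<comment> \<open>The integral of \<open>Re (Q dz)\<close> along the segment from \<open>0\<close>
    to \<open>z\<close>.\<close>
  define F where "F z = integral (cbox 0 1) (\<lambda>t::real. Re (Q (of_real t * z) * z))" for z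
  \<comment> \<open>Chosen so that the integrand of \<open>F\<close> has the derivative
    \<open>h \<mapsto> Re (G z t * h)\<close> in \<open>z\<close>. Closedness enters here: as
    \<open>b\<close> is real, \<open>Re (b * cnj h * z) = Re (b * cnj z * h)\<close>.\<close>
  define G where "G z t = Q (of_real t * z) + of_real t *
      (a (of_real t * z) * z + of_real (b (of_real t * z)) * cnj z)" for z and t :: real
  have mem: "of_real t * z \<in> S" if "z \<in> S" "t \<in> cbox 0 1" for z and t :: real
    using that convexD_alt[OF \<open>convex S\<close> \<open>0 \<in> S\<close>, of z t] by (auto simp: scaleR_conv_of_real)
  have contQ: "continuous_on S Q"
    using Q by (meson has_derivative_continuous continuous_at_imp_continuous_on)
  have cont: "continuous_on (S \<times> cbox 0 1) (\<lambda>(z, t::real). f (of_real t * z))"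
    if "continuous_on S f" for f :: "complex \<Rightarrow> 'c::topological_space"
  proof -
    have "continuous_on (S \<times> cbox 0 (1::real)) (\<lambda>p. of_real (snd p) * fst p)"
      by (intro continuous_intros)
    from continuous_on_compose2[OF that this] mem show ?thesis
      by (fastforce simp: case_prod_unfold)
  qed
  \<comment> \<open>\<open>blinfun_inner_right (cnj w)\<close> is the map
    \<open>h \<mapsto> Re (w * h)\<close>, packed as a bounded linear function for differentiation
    under the integral sign.\<close>
  have contG: "continuous_on (S \<times> cbox 0 1) (\<lambda>(z, t). blinfun_inner_right (cnj (G z t)))"
    using cont[OF contQ] cont[OF a] cont[OF b] unfolding G_def case_prod_unfold
    by (intro continuous_intros)
  have deriv: "((\<lambda>z. Re (Q (of_real t * z) * z)) has_derivative
      blinfun_inner_right (cnj (G z t))) (at z within S)"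
    if "z \<in> S" "t \<in> cbox 0 1" for z and t :: real
  proof -
    have "((\<lambda>z. Q (of_real t * z)) has_derivative
        (\<lambda>h. a (of_real t * z) * (of_real t * h) + of_real (b (of_real t * z)) * cnj (of_real t * h)))
        (at z within S)"
      by (rule has_derivative_compose[where f = "\<lambda>z. of_real t * z" and g = Q, OF _ Q[OF mem[OF that]]])
         (auto intro!: derivative_eq_intros)
    note [derivative_intros] = this
    show ?thesis
      by (rule derivative_eq_intros refl)+
         (auto simp: G_def inner_complex_def algebra_simps)
  qed
  have int: "(\<lambda>t. Re (Q (of_real t * z) * z)) integrable_on cbox 0 1" if "z \<in> S" for z
  proof (rule integrable_continuous)
    have "continuous_on (cbox 0 1) (\<lambda>t::real. Q (of_real t * z))"
      by (rule continuous_on_compose2[OF contQ]) (use mem that in \<open>auto intro!: continuous_intros\<close>)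
    then show "continuous_on (cbox 0 1) (\<lambda>t. Re (Q (of_real t * z) * z))"
      by (intro continuous_intros)
  qed
  have "(F has_derivative (\<lambda>h. Re (Q z * h))) (at z)" if "z \<in> S" for z
  proof -
    \<comment> \<open>\<open>G z\<close> is also the \<open>t\<close>-derivative of
      \<open>t * Q (t * z)\<close>, so its integral over \<open>[0, 1]\<close> is
      \<open>Q z\<close>, the coefficient wanted for the derivative of \<open>F\<close>.\<close>
    have "((\<lambda>t::real. of_real t * Q (of_real t * z)) has_vector_derivative G z t)
        (at t within {0..1})" if t: "t \<in> {0..1}" for t
    proof -
      have "t \<in> cbox 0 1" using t by simp
      have "((\<lambda>t::real. Q (of_real t * z)) has_derivative
        (\<lambda>s. a (of_real t * z) * (of_real s * z) + of_real (b (of_real t * z)) * cnj (of_real s * z)))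
        (at t within {0..1})"
        by (rule has_derivative_compose[where f = "\<lambda>t. of_real t * z" and g = Q,
                OF _ Q[OF mem[OF \<open>z \<in> S\<close> \<open>t \<in> cbox 0 1\<close>]]])
           (auto intro!: derivative_eq_intros)
      note [derivative_intros] = this
      show ?thesis unfolding has_vector_derivative_def
        by (rule derivative_eq_intros refl)+
           (auto simp: G_def scaleR_conv_of_real algebra_simps)
    qed
    then have "((\<lambda>t::real. blinfun_inner_right (cnj (of_real t * Q (of_real t * z))))
        has_vector_derivative blinfun_inner_right (cnj (G z t))) (at t within {0..1})"
      if t: "t \<in> {0..1}" for t
      using t bounded_linear.has_vector_derivative[OF
        bounded_linear_compose[OF bounded_linear_blinfun_inner_right bounded_linear_cnj]]
      by blast
    then have "((\<lambda>t. blinfun_inner_right (cnj (G z t))) has_integral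
        blinfun_inner_right (cnj (of_real 1 * Q (of_real 1 * z)))
        - blinfun_inner_right (cnj (of_real 0 * Q (of_real 0 * z)))) {0..1}"
      by (intro fundamental_theorem_of_calculus) auto
    then have I: "integral (cbox 0 1) (\<lambda>t. blinfun_inner_right (cnj (G z t)))
        = blinfun_inner_right (cnj (Q z)) - blinfun_inner_right 0"
      by (simp add: integral_unique)
    have "(F has_derivative
        integral (cbox 0 1) (\<lambda>t. blinfun_inner_right (cnj (G z t)))) (at z within S)"
      unfolding F_def by (rule leibniz_rule[OF deriv int contG that S(2)])
    moreover have "blinfun_apply (blinfun_inner_right (cnj (Q z)) - blinfun_inner_right 0)
        = (\<lambda>h. Re (Q z * h))"
      by (auto simp: blinfun.diff_left inner_complex_def)
    ultimately show ?thesis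
      by (simp only: I at_within_open[OF that S(1)])
  qed
  then show ?thesis by blast
qed

text \<open>A Riemann map \<open>g\<close> pulls the form back to \<open>Re ((Q \<circ> g) g' dz)\<close>, whose \<open>cnj z\<close>-derivative
  is that of \<open>Q\<close> times \<open>(cmod g')\<^sup>2\<close>, so that it stays real.\<close>

lemma has_primitive_simply_connected:
  fixes Q a :: "complex \<Rightarrow> complex" and b :: "complex \<Rightarrow> real"
  assumes S: "open S" "simply_connected S"
    and Q: "\<And>z. z \<in> S \<Longrightarrow> (Q has_derivative (\<lambda>h. a z * h + of_real (b z) * cnj h)) (at z)"
    and a: "continuous_on S a" and b: "continuous_on S b"
  shows "\<exists>F. \<forall>z\<in>S. (F has_derivative (\<lambda>h. Re (Q z * h))) (at z)"
proof -
  \<comment> \<open>The Riemann mapping theorem. The plane has no biholomorphic map onto the disc,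
    but it is convex and falls under the previous lemma directly.\<close>
  consider "S = {}" | "S = UNIV" | f g where
    "f holomorphic_on S" "g holomorphic_on ball 0 1"
    "\<And>z. z \<in> S \<Longrightarrow> f z \<in> ball 0 1 \<and> g (f z) = z"
    "\<And>z. z \<in> ball 0 1 \<Longrightarrow> g z \<in> S \<and> f (g z) = z"
    using simply_connected_eq_biholomorphic_to_disc[OF S(1)] S(2) by blast
  then show ?thesis
  proof cases
    case 2
    then show ?thesis using has_primitive_convex[OF S(1) _ _ Q a b] by simp
  next
    case (3 f g)
    let ?B = "ball (0::complex) 1"
    define g' where "g' = deriv g"
    define g'' where "g'' = deriv g'"
    define R where "R w = Q (g w) * g' w" for w
    have dg: "(g has_field_derivative g' w) (at w)" if "w \<in> ?B" for w
      unfolding g'_def using 3(2) that by (intro holomorphic_derivI[where S = ?B]) auto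
    have hg': "g' holomorphic_on ?B"
      unfolding g'_def using 3(2) by (intro holomorphic_deriv) auto
    have dg': "(g' has_field_derivative g'' w) (at w)" if "w \<in> ?B" for w
      unfolding g''_def using hg' that by (intro holomorphic_derivI[where S = ?B]) auto
    have hg'': "g'' holomorphic_on ?B"
      unfolding g''_def using hg' by (intro holomorphic_deriv) auto
    note cg = 3(2)[THEN holomorphic_on_imp_continuous_on]
      hg'[THEN holomorphic_on_imp_continuous_on] hg''[THEN holomorphic_on_imp_continuous_on]
    have contQ: "continuous_on S Q"
      using Q by (meson has_derivative_continuous continuous_at_imp_continuous_on)
    have comp: "continuous_on ?B (\<lambda>w. k (g w))" if "continuous_on S k"
      for k :: "complex \<Rightarrow> 'c::topological_space"
      by (rule continuous_on_compose2[OF that cg(1)]) (use 3(4) in auto)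
    have "(R has_derivative (\<lambda>h. (a (g w) * (g' w)\<^sup>2 + Q (g w) * g'' w) * h
        + of_real (b (g w) * (cmod (g' w))\<^sup>2) * cnj h)) (at w)" if w: "w \<in> ?B" for w
    proof -
      have 1: "((\<lambda>w. Q (g w)) has_derivative
          (\<lambda>h. a (g w) * (g' w * h) + of_real (b (g w)) * cnj (g' w * h))) (at w)"
        using has_derivative_compose[OF dg[OF w, unfolded has_field_derivative_def] Q] 3(4) w
        by blast
      note [derivative_intros] = 1 dg'[OF w, unfolded has_field_derivative_def]
      have *: "of_real (b (g w)) * cnj (g' w * h) * g' w
          = of_real (b (g w) * (cmod (g' w))\<^sup>2) * cnj h" for h
        using complex_norm_square[of "g' w"] by (simp add: algebra_simps)
      show ?thesis unfolding R_def
        by (rule derivative_eq_intros refl)+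
           (use * in \<open>simp add: fun_eq_iff algebra_simps power2_eq_square\<close>)
    qed
    then have "\<exists>F. \<forall>z\<in>?B. (F has_derivative (\<lambda>h. Re (R z * h))) (at z)"
      by (intro has_primitive_convex[where a = "\<lambda>w. a (g w) * (g' w)\<^sup>2 + Q (g w) * g'' w"
            and b = "\<lambda>w. b (g w) * (cmod (g' w))\<^sup>2"])
         (use comp[OF a] comp[OF b] comp[OF contQ] cg in \<open>auto intro!: continuous_intros\<close>)
    then obtain F where F: "\<And>z. z \<in> ?B \<Longrightarrow> (F has_derivative (\<lambda>h. Re (R z * h))) (at z)"
      by blast
    \<comment> \<open>Pulling back by \<open>f\<close> undoes the pullback by \<open>g\<close>:
      differentiating \<open>g (f z) = z\<close> gives \<open>g' (f z) * deriv f z = 1\<close>,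
      which cancels the factor \<open>g'\<close> in \<open>R\<close>.\<close>
    have "((\<lambda>z. F (f z)) has_derivative (\<lambda>h. Re (Q z * h))) (at z)" if z: "z \<in> S" for z
    proof -
      have df: "(f has_field_derivative deriv f z) (at z)"
        using 3(1) S(1) z by (rule holomorphic_derivI)
      have fz: "f z \<in> ?B" "g (f z) = z" using 3(3) z by auto
      have "((\<lambda>z. g (f z)) has_field_derivative g' (f z) * deriv f z) (at z)"
        using DERIV_chain2[OF dg[OF fz(1)] df] .
      then have "((\<lambda>z. z) has_field_derivative g' (f z) * deriv f z) (at z)"
        by (rule has_field_derivative_transform_within_open[OF _ S(1) z]) (use 3(3) in auto)
      then have 1: "g' (f z) * deriv f z = 1"
        using DERIV_unique DERIV_ident by blast
      have "((\<lambda>z. F (f z)) has_derivative (\<lambda>h. Re (R (f z) * (deriv f z * h)))) (at z)"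
        using has_derivative_compose[OF df[unfolded has_field_derivative_def] F[OF fz(1)]] .
      moreover have "R (f z) * (deriv f z * h) = Q z * h" for h
        using 1 by (simp add: R_def fz(2) mult.assoc flip: mult.assoc[of "g' (f z)"])
      ultimately show ?thesis by simp
    qed
    then show ?thesis by blast
  qed auto
qed

section \<open>Line integrals of exact forms\<close>

text \<open>On a short piece of the curve \<open>Q\<close> is nearly constant, so a term of the
  Riemann-Stieltjes sum differs from the increment of \<open>F\<close> by a small multiple of the
  chord. The increments telescope, and rectifiability bounds the sum of the chords.\<close>

lemma has_line_integral_primitive:
  fixes Q :: "complex \<Rightarrow> complex"
  assumes S: "open S"
    and F: "\<And>z. z \<in> S \<Longrightarrow> (F has_derivative (\<lambda>h. Re (Q z * h))) (at z)"
    and Q: "continuous_on S Q"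
    and \<gamma>: "rectifiable_path_from_to S z0 z \<gamma>"
  shows "has_line_integral (\<lambda>w. Re (Q w)) (\<lambda>w. - Im (Q w)) \<gamma> (F z - F z0)"
  unfolding has_line_integral_def
proof (intro allI impI)
  fix e :: real assume "e > 0"
  obtain L where path: "path \<gamma>" and im: "path_image \<gamma> \<subseteq> S"
    and ends: "\<gamma> 0 = z0" "\<gamma> 1 = z"
    and L: "\<And>D. D division_of {0..1} \<Longrightarrow> (\<Sum>K\<in>D. dist (\<gamma> (Inf K)) (\<gamma> (Sup K))) \<le> L"
    using \<gamma> unfolding rectifiable_path_from_to_def rectifiable_path_def pathstart_def pathfinish_def
    by blast
  \<comment> \<open>The denominator is positive whatever the sign of \<open>L\<close>, and the total
    error, at most \<open>\<epsilon> * L\<close>, stays strictly below \<open>e\<close>.\<close>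
  define \<epsilon> where "\<epsilon> = e / (\<bar>L\<bar> + 1)"
  have \<epsilon>: "\<epsilon> > 0" "\<epsilon> * L < e"
  proof -
    show "\<epsilon> > 0" using \<open>e > 0\<close> by (simp add: \<epsilon>_def)
    have "e * L < e * (\<bar>L\<bar> + 1)" using \<open>e > 0\<close> by simp
    then show "\<epsilon> * L < e" by (simp add: \<epsilon>_def field_simps)
  qed
  \<comment> \<open>A Lebesgue number \<open>\<eta>\<close> of this cover makes the choice of radius
    uniform along the compact curve: on each \<open>ball x \<eta>\<close> centred on it,
    \<open>Q\<close> differs from \<open>Q x\<close> by at most \<open>\<epsilon>\<close>.\<close>
  define \<G> where "\<G> = {ball w r | w r. ball w r \<subseteq> S \<and> (\<forall>x\<in>ball w r. cmod (Q x - Q w) \<le> \<epsilon>/2)}"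
  have cover: "path_image \<gamma> \<subseteq> \<Union>\<G>"
  proof
    fix w assume "w \<in> path_image \<gamma>"
    then have w: "w \<in> S" using im by blast
    obtain r1 where r1: "r1 > 0" "ball w r1 \<subseteq> S" using S w by (auto simp: open_contains_ball)
    obtain r2 where r2: "r2 > 0" "\<And>x. x \<in> S \<Longrightarrow> dist x w < r2 \<Longrightarrow> dist (Q x) (Q w) < \<epsilon>/2"
      using Q w \<epsilon>(1) unfolding continuous_on_iff by (meson half_gt_zero)
    have "ball w (min r1 r2) \<in> \<G>" unfolding \<G>_def
      using r1 r2(2) by (force simp: dist_norm norm_minus_commute subset_iff)
    then show "w \<in> \<Union>\<G>" using r1(1) r2(1) by (auto intro!: bexI[of _ "ball w (min r1 r2)"])
  qed
  have "open G" if "G \<in> \<G>" for G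
    using that by (auto simp: \<G>_def)
  with Heine_Borel_lemma[OF compact_path_image[OF path] cover]
  obtain \<eta> where \<eta>: "\<eta> > 0" "\<And>x. x \<in> path_image \<gamma> \<Longrightarrow> \<exists>G\<in>\<G>. ball x \<eta> \<subseteq> G"
    by metis
  have approx: "\<bar>F q - F p - Re (Q x * (q - p))\<bar> \<le> \<epsilon> * dist p q"
    if x: "x \<in> path_image \<gamma>" and pq: "p \<in> ball x \<eta>" "q \<in> ball x \<eta>" for x p q
  proof -
    from \<eta>(2)[OF x] obtain w r where wr: "ball x \<eta> \<subseteq> ball w r" "ball w r \<subseteq> S"
      "\<And>y. y \<in> ball w r \<Longrightarrow> cmod (Q y - Q w) \<le> \<epsilon>/2"
      unfolding \<G>_def by blast
    \<comment> \<open>Mean value inequality for \<open>F\<close> minus the linear function with the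
      coefficient frozen at \<open>x\<close>.\<close>
    have "norm ((F q - Re (Q x * q)) - (F p - Re (Q x * p))) \<le> \<epsilon> * norm (q - p)"
    proof (rule differentiable_bound[OF convex_ball[of x \<eta>]])
      fix y assume y: "y \<in> ball x \<eta>"
      then have "y \<in> S" using wr by blast
      show "((\<lambda>y. F y - Re (Q x * y)) has_derivative (\<lambda>h. Re ((Q y - Q x) * h))) (at y within ball x \<eta>)"
        by (rule derivative_eq_intros refl has_derivative_at_withinI[OF F[OF \<open>y \<in> S\<close>]])+
           (simp add: fun_eq_iff algebra_simps)
      have "y \<in> ball w r" "x \<in> ball w r"
        using subsetD[OF wr(1) y] subsetD[OF wr(1), of x] \<eta>(1) by simp_all
      then have "cmod (Q y - Q w) \<le> \<epsilon>/2" "cmod (Q w - Q x) \<le> \<epsilon>/2"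
        using wr(3)[of y] wr(3)[of x] by (simp_all add: norm_minus_commute)
      then have "cmod (Q y - Q x) \<le> \<epsilon>/2 + \<epsilon>/2"
        by (rule norm_diff_triangle_le)
      then have Qyx: "cmod (Q y - Q x) \<le> \<epsilon>" by simp
      show "onorm (\<lambda>h. Re ((Q y - Q x) * h)) \<le> \<epsilon>"
      proof (rule onorm_bound)
        fix h
        have "\<bar>Re ((Q y - Q x) * h)\<bar> \<le> cmod ((Q y - Q x) * h)" by (rule abs_Re_le_cmod)
        also have "\<dots> \<le> \<epsilon> * norm h" using Qyx by (simp add: norm_mult mult_right_mono)
        finally show "norm (Re ((Q y - Q x) * h)) \<le> \<epsilon> * norm h" by simp
      qed (use \<epsilon> in simp)
    qed (use pq in auto)
    then show ?thesis by (simp add: dist_norm norm_minus_commute algebra_simps)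
  qed
  \<comment> \<open>Gives the mesh \<open>d\<close> for which the endpoints of every piece are
    mapped into the \<open>\<eta>\<close>-ball about the image of its tag.\<close>
  have "uniformly_continuous_on {0..1} \<gamma>"
    using path by (simp add: path_def compact_uniformly_continuous)
  then obtain d where d: "d > 0"
    "\<And>s t. s \<in> {0..1} \<Longrightarrow> t \<in> {0..1} \<Longrightarrow> dist s t < d \<Longrightarrow> dist (\<gamma> s) (\<gamma> t) < \<eta>"
    using \<eta>(1) unfolding uniformly_continuous_on_def by meson
  have "\<bar>(\<Sum>(t, K)\<in>p. Re (Q (\<gamma> t)) * (Re (\<gamma> (Sup K)) - Re (\<gamma> (Inf K)))
      + - Im (Q (\<gamma> t)) * (Im (\<gamma> (Sup K)) - Im (\<gamma> (Inf K)))) - (F z - F z0)\<bar> < e"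
    if p: "p tagged_division_of {0..1}" and fine: "(\<lambda>t. ball t d) fine p" for p
  proof -
    define T where "T t K = Re (Q (\<gamma> t) * (\<gamma> (Sup K) - \<gamma> (Inf K)))" for t K
    \<comment> \<open>\<open>Inf {}\<close> and \<open>Sup {}\<close> are unspecified reals, so the empty set is treated separately.\<close>
    define len where "len K = (if K = {} then 0 else dist (\<gamma> (Inf K)) (\<gamma> (Sup K)))" for K :: "real set"
    have "(\<Sum>(t, K)\<in>p. F (\<gamma> (Sup K)) - F (\<gamma> (Inf K))) = F z - F z0"
      using additive_tagged_division_1[OF _ p, of "\<lambda>t. F (\<gamma> t)"] by (simp add: ends)
    then have "\<bar>(\<Sum>(t, K)\<in>p. T t K) - (F z - F z0)\<bar>
        = \<bar>\<Sum>(t, K)\<in>p. T t K - (F (\<gamma> (Sup K)) - F (\<gamma> (Inf K)))\<bar>"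
      by (simp add: case_prod_unfold sum_subtractf)
    also have "\<dots> \<le> (\<Sum>(t, K)\<in>p. \<epsilon> * dist (\<gamma> (Inf K)) (\<gamma> (Sup K)))"
      unfolding case_prod_unfold
    proof (rule order_trans[OF sum_abs], rule sum_mono)
      fix tK assume "tK \<in> p"
      then obtain t K where tK: "tK = (t, K)" "(t, K) \<in> p" by (metis surj_pair)
      obtain u v where K: "K = {u..v}" using tagged_division_ofD(4)[OF p tK(2)] by auto
      have tin: "t \<in> K" and sub: "K \<subseteq> {0..1}" using tagged_division_ofD(2,3)[OF p tK(2)] by auto
      then have uv: "u \<le> t" "t \<le> v" "u \<in> K" "v \<in> K" using K by auto
      have "K \<subseteq> ball t d" using fine tK(2) by (auto simp: fine_def)
      then have "dist t u < d" "dist t v < d" using uv by auto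
      then have "\<gamma> u \<in> ball (\<gamma> t) \<eta>" "\<gamma> v \<in> ball (\<gamma> t) \<eta>"
        using d(2) tin uv sub by (auto simp: subset_iff)
      moreover have "\<gamma> t \<in> path_image \<gamma>" using tin sub by (auto simp: path_image_def)
      moreover have "Inf K = u" "Sup K = v" using uv K by auto
      ultimately show "\<bar>T (fst tK) (snd tK) - (F (\<gamma> (Sup (snd tK))) - F (\<gamma> (Inf (snd tK))))\<bar>
          \<le> \<epsilon> * dist (\<gamma> (Inf (snd tK))) (\<gamma> (Sup (snd tK)))"
        using approx[of "\<gamma> t" "\<gamma> u" "\<gamma> v"] by (simp add: tK(1) T_def abs_minus_commute)
    qed
    also have "\<dots> = \<epsilon> * (\<Sum>(t, K)\<in>p. dist (\<gamma> (Inf K)) (\<gamma> (Sup K)))"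
      by (simp add: sum_distrib_left case_prod_unfold)
    also have "(\<Sum>(t, K)\<in>p. dist (\<gamma> (Inf K)) (\<gamma> (Sup K))) = (\<Sum>(t, K)\<in>p. len K)"
      using tagged_division_ofD(2)[OF p] by (intro sum.cong) (fastforce simp: len_def)+
    \<comment> \<open>The bound \<open>L\<close> concerns untagged divisions. Dropping the tags is
      harmless because \<open>len\<close> vanishes on intervals with empty interior.\<close>
    also have "\<dots> = (\<Sum>K\<in>snd ` p. len K)"
      by (rule sum.over_tagged_division_lemma[OF p]) (auto simp: len_def)
    also have "\<dots> = (\<Sum>K\<in>snd ` p. dist (\<gamma> (Inf K)) (\<gamma> (Sup K)))"
      using tagged_division_ofD(2)[OF p] by (intro sum.cong) (fastforce simp: len_def)+
    also have "\<epsilon> * \<dots> \<le> \<epsilon> * L"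
      using \<epsilon>(1) L[OF division_of_tagged_division[OF p]] by simp
    finally show ?thesis using \<epsilon>(2) by (simp add: T_def)
  qed
  then show "\<exists>d>0. \<forall>p. p tagged_division_of {0..1} \<and> (\<lambda>t. ball t d) fine p \<longrightarrow>
        \<bar>(\<Sum>(t, K)\<in>p. Re (Q (\<gamma> t)) * (Re (\<gamma> (Sup K)) - Re (\<gamma> (Inf K)))
      + - Im (Q (\<gamma> t)) * (Im (\<gamma> (Sup K)) - Im (\<gamma> (Inf K)))) - (F z - F z0)\<bar> < e"
    using d(1) by blast
qed

section \<open>The Schroedinger equation\<close>

text \<open>The hypothesis on \<open>A\<close> says that its gradient is
  \<open>(2 Re Q, - 2 Im Q)\<close>. Second derivatives of \<open>A\<close> are thus first
  derivatives of \<open>Q\<close>, and \<open>Q\<close> being C1 makes the exponential C2.\<close>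

lemma schroedinger_solution_exp:
  fixes Q :: "complex \<Rightarrow> complex" and A :: "complex \<Rightarrow> real"
  assumes S: "open S" and Q: "riccati_solution S \<nu> Q"
    and A: "\<And>z. z \<in> S \<Longrightarrow> (A has_derivative (\<lambda>h. 2 * Re (Q z * h))) (at z)"
  shows "schroedinger_solution S \<nu> (\<lambda>z. exp (A z))"
proof -
  define u where "u z = exp (A z)" for z
  define Qx where "Qx = partial_x Q"
  define Qy where "Qy = partial_y Q"
  have dQ: "(Q has_derivative (\<lambda>h. Re h *\<^sub>R Qx z + Im h *\<^sub>R Qy z)) (at z)" if "z \<in> S" for z
    using Q that unfolding riccati_solution_def C1_on_def Qx_def Qy_def
    by (blast intro: differentiable_imp_has_derivative_partials)
  have contQ: "continuous_on S Q"
    using dQ by (meson has_derivative_continuous continuous_at_imp_continuous_on)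
  have contx: "continuous_on S Qx" and conty: "continuous_on S Qy"
    using Q by (auto simp: riccati_solution_def C1_on_def Qx_def Qy_def)
  have du: "(u has_derivative (\<lambda>h. u z * (2 * Re (Q z * h)))) (at z)" if "z \<in> S" for z
    unfolding u_def using A[OF that] by (auto intro!: derivative_eq_intros)
  have contu: "continuous_on S u"
    using du by (meson has_derivative_continuous continuous_at_imp_continuous_on)
  have ux: "partial_x u z = 2 * Re (Q z) * u z" and uy: "partial_y u z = - 2 * Im (Q z) * u z"
    if "z \<in> S" for z
    using has_derivative_imp_partial_x[OF du[OF that]] has_derivative_imp_partial_y[OF du[OF that]]
    by auto
  \<comment> \<open>The formulas for the partials of \<open>u\<close> hold on \<open>S\<close> only;
    openness of \<open>S\<close> allows them to be differentiated once more.\<close>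
  have dux: "(partial_x u has_derivative (\<lambda>h. 2 * Re (Re h *\<^sub>R Qx z + Im h *\<^sub>R Qy z) * u z
      + 2 * Re (Q z) * (u z * (2 * Re (Q z * h))))) (at z)" if z: "z \<in> S" for z
  proof (rule has_derivative_transform_within_open[OF _ S z])
    show "((\<lambda>z. 2 * Re (Q z) * u z) has_derivative (\<lambda>h. 2 * Re (Re h *\<^sub>R Qx z + Im h *\<^sub>R Qy z) * u z
      + 2 * Re (Q z) * (u z * (2 * Re (Q z * h))))) (at z)"
      by (rule derivative_eq_intros refl dQ[OF z] du[OF z])+ (simp add: fun_eq_iff algebra_simps)
  qed (simp add: ux)
  have duy: "(partial_y u has_derivative (\<lambda>h. - 2 * Im (Re h *\<^sub>R Qx z + Im h *\<^sub>R Qy z) * u z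
      - 2 * Im (Q z) * (u z * (2 * Re (Q z * h))))) (at z)" if z: "z \<in> S" for z
  proof (rule has_derivative_transform_within_open[OF _ S z])
    show "((\<lambda>z. - 2 * Im (Q z) * u z) has_derivative (\<lambda>h. - 2 * Im (Re h *\<^sub>R Qx z + Im h *\<^sub>R Qy z) * u z
      - 2 * Im (Q z) * (u z * (2 * Re (Q z * h))))) (at z)"
      by (rule derivative_eq_intros refl dQ[OF z] du[OF z])+ (simp add: fun_eq_iff algebra_simps)
  qed (simp add: uy)
  \<comment> \<open>Reduces each C1 claim to continuity of the explicit expressions obtained from
    the derivative at \<open>1\<close> and \<open>\<i>\<close>.\<close>
  have C1I: "C1_on S f" if f: "\<And>z. z \<in> S \<Longrightarrow> (f has_derivative D z) (at z)"
    and "continuous_on S (\<lambda>z. D z 1)" "continuous_on S (\<lambda>z. D z \<i>)"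
    for f :: "complex \<Rightarrow> real" and D
    unfolding C1_on_def using that(2,3) has_derivative_imp_partial_x[OF f]
      has_derivative_imp_partial_y[OF f] f
    by (auto simp: differentiable_def cong: continuous_on_cong)
  have "C1_on S u" "C1_on S (partial_x u)" "C1_on S (partial_y u)"
    by (rule C1I[OF du] C1I[OF dux] C1I[OF duy];
        auto intro!: continuous_intros contQ contu contx conty)+
  moreover have "- laplacian u z + \<nu> z * u z = 0" if z: "z \<in> S" for z
  proof -
    have "dzbar Q z + of_real ((cmod (Q z))\<^sup>2) = of_real (\<nu> z / 4)"
      using Q z by (simp add: riccati_solution_def)
    then have "Re (dzbar Q z + of_real ((cmod (Q z))\<^sup>2)) = \<nu> z / 4"
      by (simp only: Re_complex_of_real)
    \<comment> \<open>Four times the real part of the Riccati equation. Times \<open>u z\<close>,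
      the right-hand side is the sum of \<open>dux\<close> at \<open>1\<close> and
      \<open>duy\<close> at \<open>\<i>\<close>, that is, the Laplacian.\<close>
    then have \<nu>: "\<nu> z = 2 * (Re (Qx z) - Im (Qy z)) + 4 * ((Re (Q z))\<^sup>2 + (Im (Q z))\<^sup>2)"
      by (simp add: dzbar_def Qx_def Qy_def cmod_power2 field_simps)
    show ?thesis
      unfolding laplacian_def has_derivative_imp_partial_x[OF dux[OF z]]
        has_derivative_imp_partial_y[OF duy[OF z]] \<nu>
      by (simp add: algebra_simps power2_eq_square)
  qed
  ultimately show ?thesis by (simp add: schroedinger_solution_def C2_on_def u_def[abs_def])
qed

theorem theorem7:
  fixes \<Omega> :: "complex set" and \<nu> :: "complex \<Rightarrow> real" and Q :: "complex \<Rightarrow> complex"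
    and z0 :: complex and c :: real and \<Gamma> :: "complex \<Rightarrow> real \<Rightarrow> complex"
  assumes "open \<Omega>" and "connected \<Omega>" and "simply_connected \<Omega>"
    and "riccati_solution \<Omega> \<nu> Q"
    and "z0 \<in> \<Omega>"
    and "\<And>z. z \<in> \<Omega> \<Longrightarrow> rectifiable_path_from_to \<Omega> z0 z (\<Gamma> z)"
  shows "schroedinger_solution \<Omega> \<nu> (\<lambda>z. exp (A_op \<Gamma> c Q z))"
proof -
  \<comment> \<open>The two Wirtinger derivatives of \<open>Q\<close>; for the second one only the
    real part is kept.\<close>
  define a where "a z = (partial_x Q z - \<i> * partial_y Q z) / 2" for z
  define b where "b z = Re (dzbar Q z)" for z
  have C1: "C1_on \<Omega> Q" using assms(4) by (simp add: riccati_solution_def)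
  have dQ: "(Q has_derivative (\<lambda>h. a z * h + of_real (b z) * cnj h)) (at z)" if z: "z \<in> \<Omega>" for z
  proof -
    \<comment> \<open>Since \<open>\<nu>\<close> and the squared modulus are real, so is
      \<open>dzbar Q z\<close>; it therefore equals \<open>b z\<close>, and the form
      \<open>Re (Q dz)\<close> is closed.\<close>
    have "dzbar Q z = of_real (\<nu> z / 4) - of_real ((cmod (Q z))\<^sup>2)"
      using assms(4) z unfolding riccati_solution_def by (metis add_diff_cancel_right')
    then have "of_real (b z) = dzbar Q z" by (simp add: b_def)
    moreover have "a z * h + dzbar Q z * cnj h = Re h *\<^sub>R partial_x Q z + Im h *\<^sub>R partial_y Q z" for h
      by (simp add: a_def dzbar_def complex_eq_iff field_simps)
    ultimately have "a z * h + of_real (b z) * cnj h = Re h *\<^sub>R partial_x Q z + Im h *\<^sub>R partial_y Q z" for h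
      by simp
    then show ?thesis
      using C1 z differentiable_imp_has_derivative_partials[of Q z] by (simp add: C1_on_def)
  qed
  have "continuous_on \<Omega> a" "continuous_on \<Omega> b"
    using C1 unfolding a_def b_def dzbar_def C1_on_def by (auto intro!: continuous_intros)
  then obtain F where F: "\<And>z. z \<in> \<Omega> \<Longrightarrow> (F has_derivative (\<lambda>h. Re (Q z * h))) (at z)"
    using has_primitive_simply_connected[OF assms(1,3) dQ] by blast
  have contQ: "continuous_on \<Omega> Q"
    using dQ by (meson has_derivative_continuous continuous_at_imp_continuous_on)
  \<comment> \<open>The line integral is unique, so \<open>THE\<close> picks the increment of
    \<open>F\<close>. The value depends on \<open>\<Gamma> z\<close> only through its endpoints, so
    curves chosen independently for different \<open>z\<close> still give a differentiable
    function.\<close>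
  have A: "A_op \<Gamma> c Q z = 2 * (F z - F z0) + c" if "z \<in> \<Omega>" for z
    using has_line_integral_primitive[OF assms(1) F contQ assms(6)[OF that]]
      has_line_integral_unique
    unfolding A_op_def line_integral_def by (metis (no_types, lifting) the_equality)
  show ?thesis
  proof (rule schroedinger_solution_exp[OF assms(1,4)])
    fix z assume z: "z \<in> \<Omega>"
    have "((\<lambda>z. 2 * (F z - F z0) + c) has_derivative (\<lambda>h. 2 * Re (Q z * h))) (at z)"
      by (rule derivative_eq_intros refl F[OF z])+ simp
    then show "(A_op \<Gamma> c Q has_derivative (\<lambda>h. 2 * Re (Q z * h))) (at z)"
      by (rule has_derivative_transform_within_open[OF _ assms(1) z]) (simp add: A)
  qed
qed

end
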